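(* Let $A$ be a self-adjoint operator in a Hilbert space $H$ with domain $D(A)$. Then there exist closed linear subspaces $H_-,H_+\subset H$ such that the restrictions $A_\pm=A|_{D(A)\cap H_\pm}$ are self-adjoint operators in $H_\pm$ and $$H=H_-\oplus H_+,\qquad A=A_-\oplus A_+,\qquad A_-\le 0\le A_+ .$$
   Context: Hilbert spaces may be real or complex. $H=H_-\oplus H_+$ is an orthogonal direct sum. $A=A_-\oplus A_+$ means that $x=x_-+x_+$ (with $x_\pm\in H_\pm$) lies in $D(A)$ if and only if $x_-\in D(A_-)$ and $x_+\in D(A_+)$, and then $Ax=A_-x_-+A_+x_+$, where $A_\pm x_\pm\in H_\pm$. $A_+\ge0$ (resp. $A_-\le0$) means $\langle A_+x,x\rangle\ge0$ for all $x\in D(A_+)$ (resp. $\langle A_-x,x\rangle\le 0$ for all $x\in D(A_-)$). *)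

theory Defs
  imports "HOL-Analysis.Analysis" "HOL-Library.Nonpos_Ints"
begin

(* The two scalar fields of Hilbert space theory. By Gelfand-Mazur every instance is a copy of
   real (with trivial conjugation) or of complex (with complex conjugation). *)
class real_or_complex = real_normed_field +
  fixes conj :: "'a \<Rightarrow> 'a"
  assumes conj_add: "conj (x + y) = conj x + conj y"
    and conj_mult: "conj (x * y) = conj x * conj y"
    and conj_conj: "conj (conj x) = x"
    and conj_scaleR: "conj (r *\<^sub>R x) = r *\<^sub>R conj x"
    and mult_conj: "x * conj x = (norm x)\<^sup>2 *\<^sub>R 1"

instantiation real :: real_or_complex
begin
definition conj_real :: "real \<Rightarrow> real" where "conj_real x = x"
instance by standard (simp_all add: conj_real_def power2_eq_square)
end

instantiation complex :: real_or_complex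
begin
definition conj_complex :: "complex \<Rightarrow> complex" where "conj_complex = cnj"
instance by standard (simp_all add: conj_complex_def complex_norm_square scaleR_conv_of_real del: of_real_power)
end

(* A Hilbert space over 'k. The sort of 'h provides the underlying real Hilbert space: its norm,
   hence its topology and completeness, is the one induced by ip (axiom ip_self), and by
   polarization its real inner product is the real part of ip. *)
locale hilbert_space = vector_space scale
  for scale :: "'k::real_or_complex \<Rightarrow> 'h::{real_inner, complete_space} \<Rightarrow> 'h" +
  fixes ip :: "'h \<Rightarrow> 'h \<Rightarrow> 'k"
  assumes scale_of_real: "scale (of_real r) x = r *\<^sub>R x"
    and ip_add_left: "ip (x + y) z = ip x z + ip y z"
    and ip_scale_left: "ip (scale c x) y = c * ip x y"
    and ip_commute: "ip y x = conj (ip x y)"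
    and ip_self: "ip x x = of_real ((norm x)\<^sup>2)"
begin

definition closed_subspace :: "'h set \<Rightarrow> bool" where
  "closed_subspace S \<longleftrightarrow> subspace S \<and> closed S"

definition orthogonal_direct_sum :: "'h set \<Rightarrow> 'h set \<Rightarrow> 'h set \<Rightarrow> bool" where
  "orthogonal_direct_sum H U V \<longleftrightarrow>
     (\<forall>u\<in>U. \<forall>v\<in>V. ip u v = 0) \<and> H = {u + v | u v. u \<in> U \<and> v \<in> V}"

(* Unbounded operators are partial functions: the domain of A is dom A, and the restriction of A
   to the intersection of its domain with S is A |` S. The subspace S below plays the role of the
   Hilbert space in which the operator acts. *)
definition linear_operator_in :: "'h set \<Rightarrow> ('h \<rightharpoonup> 'h) \<Rightarrow> bool" where
  "linear_operator_in S A \<longleftrightarrow>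
     subspace (dom A) \<and> dom A \<subseteq> S \<and> ran A \<subseteq> S \<and>
     (\<forall>x\<in>dom A. \<forall>y\<in>dom A. the (A (x + y)) = the (A x) + the (A y)) \<and>
     (\<forall>c. \<forall>x\<in>dom A. the (A (scale c x)) = scale c (the (A x)))"

definition is_adjoint_value :: "'h set \<Rightarrow> ('h \<rightharpoonup> 'h) \<Rightarrow> 'h \<Rightarrow> 'h \<Rightarrow> bool" where
  "is_adjoint_value S A y z \<longleftrightarrow> z \<in> S \<and> (\<forall>x\<in>dom A. ip (the (A x)) y = ip x z)"

(* The value z is unique as soon as dom A is dense in S. *)
definition adjoint_in :: "'h set \<Rightarrow> ('h \<rightharpoonup> 'h) \<Rightarrow> ('h \<rightharpoonup> 'h)" where
  "adjoint_in S A = (\<lambda>y.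
     if y \<in> S \<and> (\<exists>z. is_adjoint_value S A y z) then Some (THE z. is_adjoint_value S A y z)
     else None)"

definition self_adjoint_in :: "'h set \<Rightarrow> ('h \<rightharpoonup> 'h) \<Rightarrow> bool" where
  "self_adjoint_in S A \<longleftrightarrow>
     linear_operator_in S A \<and> S \<subseteq> closure (dom A) \<and> adjoint_in S A = A"

definition operator_direct_sum ::
    "'h set \<Rightarrow> 'h set \<Rightarrow> ('h \<rightharpoonup> 'h) \<Rightarrow> ('h \<rightharpoonup> 'h) \<Rightarrow> ('h \<rightharpoonup> 'h) \<Rightarrow> bool" where
  "operator_direct_sum U V A B C \<longleftrightarrow>
     (\<forall>u\<in>U. \<forall>v\<in>V.
        (u + v \<in> dom A \<longleftrightarrow> u \<in> dom B \<and> v \<in> dom C) \<and>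
        (u + v \<in> dom A \<longrightarrow>
           the (A (u + v)) = the (B u) + the (C v) \<and> the (B u) \<in> U \<and> the (C v) \<in> V))"

(* Membership in the nonnegative (nonpositive) reals includes that the number is real. *)
definition nonneg_operator :: "('h \<rightharpoonup> 'h) \<Rightarrow> bool" where
  "nonneg_operator A \<longleftrightarrow> (\<forall>x\<in>dom A. ip (the (A x)) x \<in> \<real>\<^sub>\<ge>\<^sub>0)"

definition nonpos_operator :: "('h \<rightharpoonup> 'h) \<Rightarrow> bool" where
  "nonpos_operator A \<longleftrightarrow> (\<forall>x\<in>dom A. ip (the (A x)) x \<in> \<real>\<^sub>\<le>\<^sub>0)"

end

lemma hilbert_space_real:
  "hilbert_space (scaleR :: real \<Rightarrow> 'h \<Rightarrow> 'h::{real_inner, complete_space}) inner"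
  by unfold_locales
    (simp_all add: conj_real_def inner_add_left inner_commute power2_norm_eq_inner algebra_simps)

lemma hilbert_space_complex: "hilbert_space (*) (\<lambda>x y :: complex. x * cnj y)"
  by unfold_locales
    (simp_all add: conj_complex_def complex_norm_square scaleR_conv_of_real algebra_simps
      del: of_real_power)

end

theory Submission imports Defs begin

text \<open>
  In \<open>H \<times> H\<close>, viewed as a real Hilbert space, the orthogonal projection onto the graph of
  \<open>A\<close> is the block matrix with rows \<open>(R, B)\<close> and \<open>(B, 1 - R)\<close>, where
  \<open>R = (1 + A\<^sup>2)\<^sup>-\<^sup>1\<close> and \<open>B = A R\<close> are commuting symmetric contractions.
  With \<open>|B|\<close> the square root of \<open>B\<^sup>2\<close>, put \<open>H\<^sub>+ = ker (|B| - B)\<close> and let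
  \<open>H\<^sub>-\<close> be its orthogonal complement, on which \<open>B = - |B|\<close>. Both subspaces are invariant under
  \<open>R\<close> and \<open>B\<close>, so the graph of \<open>A\<close> splits along them. The signs follow from
  \<open>\<langle>A x, x\<rangle> = \<langle>B x, x\<rangle> + \<langle>B A x, A x\<rangle>\<close>. The subspaces
  \<open>H\<^sub>\<plusminus>\<close> are invariant under complex scalars because these preserve the graph.
\<close>

subsection \<open>Orthogonal complements in a real Hilbert space\<close>

text \<open>A minimizing sequence is Cauchy: midpoints of its members stay in \<open>S\<close>, so
  the parallelogram law bounds distances by the excess of \<open>f\<close> over its infimum
  \<open>D\<close>. The limit lies in \<open>S\<close> by closedness.\<close>

lemma closed_subspace_nearest_point:
  fixes S :: "'a::{real_inner, complete_space} set"
  assumes "subspace S" and "closed S"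
  obtains s where "s \<in> S" and "\<And>t. t \<in> S \<Longrightarrow> norm (x - s) \<le> norm (x - t)"
proof -
  define f where "f s = (norm (x - s))\<^sup>2" for s
  define D where "D = (INF s\<in>S. f s)"
  have "0 \<in> S"
    using assms(1) by (rule subspace_0)
  have bdd: "bdd_below (f ` S)"
    by (rule bdd_belowI2[where m = 0]) (simp add: f_def)
  have D_le: "D \<le> f s" if "s \<in> S" for s
    unfolding D_def using bdd that by (rule cINF_lower)
  have "\<exists>s\<in>S. f s < D + inverse (real (Suc n))" for n
    using cInf_lessD[of "f ` S" "D + inverse (real (Suc n))"] \<open>0 \<in> S\<close>
    unfolding D_def by force
  then obtain s where s: "\<And>n. s n \<in> S" "\<And>n. f (s n) < D + inverse (real (Suc n))"
    by metis
  have close: "(norm (s m - s n))\<^sup>2 < 2 * inverse (real (Suc m)) + 2 * inverse (real (Suc n))"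
    for m n
  proof -
    have "(1/2) *\<^sub>R (s m + s n) \<in> S"
      using assms(1) s(1) by (intro subspace_scale subspace_add)
    then have "D \<le> f ((1/2) *\<^sub>R (s m + s n))"
      by (rule D_le)
    \<comment> \<open>The parallelogram law for \<open>x - s m\<close> and \<open>x - s n\<close>;
      half their sum is \<open>x\<close> minus the midpoint.\<close>
    moreover have "(norm (s m - s n))\<^sup>2
        = 2 * f (s m) + 2 * f (s n) - 4 * f ((1/2) *\<^sub>R (s m + s n))"
      unfolding f_def power2_norm_eq_inner
      by (simp add: inner_diff inner_add inner_commute algebra_simps)
    ultimately show ?thesis
      using s(2)[of m] s(2)[of n] by linarith
  qed
  have "Cauchy s"
  proof (rule CauchyI)
    fix e :: real assume "e > 0"
    then have "e\<^sup>2 / 4 > 0"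
      by simp
    then obtain N where N: "inverse (real (Suc N)) < e\<^sup>2 / 4"
      using reals_Archimedean by blast
    have "norm (s m - s n) < e" if "m \<ge> N" "n \<ge> N" for m n
    proof -
      have "inverse (real (Suc m)) \<le> inverse (real (Suc N))"
        "inverse (real (Suc n)) \<le> inverse (real (Suc N))"
        using that by (simp_all add: field_simps)
      with close[of m n] N have "(norm (s m - s n))\<^sup>2 < e\<^sup>2"
        by linarith
      then show ?thesis
        using \<open>e > 0\<close> power_less_imp_less_base by fastforce
    qed
    then show "\<exists>M. \<forall>m\<ge>M. \<forall>n\<ge>M. norm (s m - s n) < e"
      by blast
  qed
  then obtain l where l: "s \<longlonglongrightarrow> l"
    using Cauchy_convergent convergent_def by blast
  have "l \<in> S"
    using assms(2) s(1) l closed_sequentially by blast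
  have "(\<lambda>n. f (s n)) \<longlonglongrightarrow> f l"
    unfolding f_def by (intro tendsto_intros l)
  moreover have "(\<lambda>n. D + inverse (real (Suc n))) \<longlonglongrightarrow> D + 0"
    by (intro tendsto_intros LIMSEQ_inverse_real_of_nat)
  ultimately have "f l \<le> D + 0"
    by (rule LIMSEQ_le) (use s(2) less_imp_le in blast)
  then have "f l \<le> f t" if "t \<in> S" for t
    using D_le[OF that] by linarith
  then have "norm (x - l) \<le> norm (x - t)" if "t \<in> S" for t
    using that unfolding f_def by (meson norm_ge_zero power2_le_imp_le)
  with \<open>l \<in> S\<close> show thesis
    by (rule that)
qed

text \<open>The nearest point serves as \<open>u\<close>: moving it along any \<open>t\<close> in
  \<open>S\<close> cannot shorten the residual, which forces the residual to be orthogonal to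
  \<open>t\<close>.\<close>

lemma orthogonal_decomposition:
  fixes S :: "'a::{real_inner, complete_space} set"
  assumes "subspace S" and "closed S"
  obtains u v where "u \<in> S" and "v \<in> S\<^sup>\<bottom>" and "x = u + v"
proof -
  obtain s where s: "s \<in> S" "\<And>t. t \<in> S \<Longrightarrow> norm (x - s) \<le> norm (x - t)"
    using closed_subspace_nearest_point[OF assms] by metis
  have "inner t (x - s) = 0" if "t \<in> S" for t
  proof (cases "t = 0")
    case False
    then have pos: "inner t t > 0"
      by simp
    \<comment> \<open>The coefficient of the projection of \<open>x - s\<close> onto the line
      through \<open>t\<close>; it minimizes the norm of \<open>x - s - a t\<close>.\<close>
    define a where "a = inner t (x - s) / inner t t"
    have "s + a *\<^sub>R t \<in> S"
      using assms(1) s(1) that by (intro subspace_add subspace_scale)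
    then have "norm (x - s) \<le> norm (x - s - a *\<^sub>R t)"
      using s(2) by (metis diff_diff_eq)
    then have "(norm (x - s))\<^sup>2 \<le> (norm (x - s - a *\<^sub>R t))\<^sup>2"
      by simp
    also have "\<dots> = (norm (x - s))\<^sup>2 - 2 * a * inner t (x - s) + a * a * inner t t"
      unfolding power2_norm_eq_inner
      by (simp add: inner_diff inner_commute algebra_simps)
    also have "\<dots> = (norm (x - s))\<^sup>2 - (inner t (x - s))\<^sup>2 / inner t t"
      using pos by (simp add: a_def field_simps power2_eq_square)
    finally have "(inner t (x - s))\<^sup>2 / inner t t \<le> 0"
      by simp
    then show ?thesis
      using pos by (simp add: divide_le_0_iff)
  qed simp
  then have "x - s \<in> S\<^sup>\<bottom>"
    by (simp add: orthogonal_comp_def orthogonal_def)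
  then show thesis
    using that[of s "x - s"] s(1) by simp
qed

lemma orthogonal_comp_inner:
  "u \<in> S \<Longrightarrow> v \<in> S\<^sup>\<bottom> \<Longrightarrow> inner u v = 0"
  by (simp add: orthogonal_comp_def orthogonal_def)

lemma closed_orthogonal_comp: "closed (S\<^sup>\<bottom>)"
proof -
  have "S\<^sup>\<bottom> = (\<Inter>y\<in>S. {x. inner y x = 0})"
    by (auto simp: orthogonal_comp_def orthogonal_def)
  moreover have "closed (\<Inter>y\<in>S. {x. inner y x = 0})"
    by (intro closed_INT ballI closed_Collect_eq continuous_intros)
  ultimately show ?thesis
    by simp
qed

lemma orthogonal_decomposition_unique:
  assumes "subspace S" "u + v = u' + v'" "u \<in> S" "u' \<in> S" "v \<in> S\<^sup>\<bottom>" "v' \<in> S\<^sup>\<bottom>"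
  shows "u = u' \<and> v = v'"
proof -
  have eq: "u - u' = v' - v"
    using assms(2) by (simp add: algebra_simps)
  have "u - u' \<in> S" "v' - v \<in> S\<^sup>\<bottom>"
    using assms subspace_orthogonal_comp by (auto intro: subspace_diff)
  then have "inner (u - u') (u - u') = 0"
    using eq orthogonal_comp_inner by metis
  then show ?thesis
    using eq by simp
qed

subsection \<open>The operator 1 - sqrt (1 - T) for a symmetric contraction T\<close>

text \<open>Fixed-point iteration for \<open>S = (T + S^2) / 2\<close>, which is equivalent to
  \<open>(1 - S)^2 = 1 - T\<close>. For linear \<open>T\<close> the iterates are polynomials in
  \<open>T\<close> with nonnegative coefficients.\<close>

primrec sqrt_iter :: "('a \<Rightarrow> 'a) \<Rightarrow> nat \<Rightarrow> 'a \<Rightarrow> 'a::real_vector" where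
  "sqrt_iter T 0 x = 0"
| "sqrt_iter T (Suc n) x = (1/2) *\<^sub>R (T x + sqrt_iter T n (sqrt_iter T n x))"

text \<open>The same iteration for \<open>T = 1\<close>; it converges, and its increments dominate those of
  \<^const>\<open>sqrt_iter\<close> for every contraction.\<close>

primrec sqrt_bound :: "nat \<Rightarrow> real" where
  "sqrt_bound 0 = 0"
| "sqrt_bound (Suc n) = (1 + (sqrt_bound n)\<^sup>2) / 2"

lemma sqrt_bound_range: "0 \<le> sqrt_bound n \<and> sqrt_bound n \<le> 1"
proof (induction n)
  case (Suc n)
  then have "(sqrt_bound n)\<^sup>2 \<le> 1"
    by (simp add: power_le_one)
  then show ?case
    by simp
qed simp

lemma sqrt_bound_incseq: "incseq sqrt_bound"
proof (rule incseq_SucI)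
  fix n
  \<comment> \<open>Half of this square is exactly the increment of \<open>sqrt_bound\<close> at
    \<open>n\<close>.\<close>
  have "0 \<le> (1 - sqrt_bound n)\<^sup>2"
    by simp
  then show "sqrt_bound n \<le> sqrt_bound (Suc n)"
    by (simp add: power2_eq_square algebra_simps)
qed

lemma sqrt_bound_Cauchy: "Cauchy sqrt_bound"
proof -
  obtain l where "sqrt_bound \<longlonglongrightarrow> l"
    using incseq_convergent[OF sqrt_bound_incseq, of 1] sqrt_bound_range by metis
  then show ?thesis
    by (rule LIMSEQ_imp_Cauchy)
qed

locale symmetric_contraction =
  fixes T :: "'a::{real_inner, complete_space} \<Rightarrow> 'a"
  assumes lin: "linear T"
    and contraction: "norm (T x) \<le> norm x"
    and symmetric: "inner (T x) y = inner x (T y)"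
begin

lemma sqrt_iter_linear: "linear (sqrt_iter T n)"
proof (induction n)
  case (Suc n)
  then show ?case
    using lin by (simp add: linear_iff algebra_simps)
qed (simp add: linear_iff)

lemma sqrt_iter_symmetric: "inner (sqrt_iter T n x) y = inner x (sqrt_iter T n y)"
  by (induction n arbitrary: x y) (simp_all add: inner_add symmetric)

lemma sqrt_iter_norm: "norm (sqrt_iter T n x) \<le> sqrt_bound n * norm x"
proof (induction n arbitrary: x)
  case (Suc n)
  have "norm (sqrt_iter T n (sqrt_iter T n x)) \<le> sqrt_bound n * (sqrt_bound n * norm x)"
    using Suc sqrt_bound_range mult_left_mono order_trans by meson
  then have "norm (T x + sqrt_iter T n (sqrt_iter T n x))
      \<le> norm x + sqrt_bound n * (sqrt_bound n * norm x)"
    using contraction[of x] by (intro norm_triangle_mono)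
  then show ?case
    by (simp add: power2_eq_square distrib_right mult.assoc del: scaleR_add_right)
qed simp

text \<open>Induction via \<open>S'^2 - S^2 = S' (S' - S) + (S' - S) S\<close>: the bounds
  \<open>s' (s' - s)\<close> and \<open>(s' - s) s\<close> add up to \<open>s'^2 - s^2\<close>,
  which drives the increments of \<open>sqrt_bound\<close>.\<close>

lemma sqrt_iter_step:
  "norm (sqrt_iter T (Suc n) x - sqrt_iter T n x) \<le> (sqrt_bound (Suc n) - sqrt_bound n) * norm x"
proof (induction n arbitrary: x)
  case 0
  then show ?case
    using sqrt_iter_norm[of 1 x] by simp
next
  case (Suc n)
  let ?S = "sqrt_iter T n" and ?S' = "sqrt_iter T (Suc n)"
  let ?s = "sqrt_bound n" and ?s' = "sqrt_bound (Suc n)"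
  have mono: "?s \<le> ?s'"
    using sqrt_bound_incseq by (simp add: incseq_SucD del: sqrt_bound.simps)
  have "norm (?S' (?S' x - ?S x)) \<le> ?s' * norm (?S' x - ?S x)"
    by (rule sqrt_iter_norm)
  also have "\<dots> \<le> ?s' * ((?s' - ?s) * norm x)"
    using Suc sqrt_bound_range mult_left_mono by blast
  finally have 1: "norm (?S' (?S' x - ?S x)) \<le> ?s' * ((?s' - ?s) * norm x)" .
  have "norm (?S' (?S x) - ?S (?S x)) \<le> (?s' - ?s) * norm (?S x)"
    by (rule Suc)
  also have "\<dots> \<le> (?s' - ?s) * (?s * norm x)"
    using mono sqrt_iter_norm by (intro mult_left_mono) auto
  finally have 2: "norm (?S' (?S x) - ?S (?S x)) \<le> (?s' - ?s) * (?s * norm x)" .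
  have "?S' (?S' x) - ?S (?S x) = ?S' (?S' x - ?S x) + (?S' (?S x) - ?S (?S x))"
    by (simp add: linear_diff[OF sqrt_iter_linear] del: sqrt_iter.simps)
  then have "norm (?S' (?S' x) - ?S (?S x)) \<le> (?s'\<^sup>2 - ?s\<^sup>2) * norm x"
    using norm_triangle_mono[OF 1 2]
    by (simp add: power2_eq_square algebra_simps del: sqrt_iter.simps sqrt_bound.simps)
  \<comment> \<open>In the difference of consecutive iterates the term \<open>T x\<close> cancels,
    leaving half a difference of squares; likewise for the bounds.\<close>
  moreover have "sqrt_iter T (Suc (Suc n)) x - ?S' x = (1/2) *\<^sub>R (?S' (?S' x) - ?S (?S x))"
    unfolding sqrt_iter.simps(2)[of T "Suc n"]
    by (subst (3) sqrt_iter.simps(2)) (simp add: algebra_simps del: sqrt_iter.simps)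
  moreover have "sqrt_bound (Suc (Suc n)) - ?s' = (1/2) * (?s'\<^sup>2 - ?s\<^sup>2)"
    unfolding sqrt_bound.simps(2)[of "Suc n"]
    by (subst (2) sqrt_bound.simps(2)) (simp add: field_simps del: sqrt_bound.simps)
  ultimately show ?case
    by (simp only: norm_scaleR)
qed

lemma sqrt_iter_diff:
  assumes "m \<le> n"
  shows "norm (sqrt_iter T n x - sqrt_iter T m x) \<le> (sqrt_bound n - sqrt_bound m) * norm x"
  using assms
proof (induction rule: dec_induct)
  case (step n)
  have "norm ((sqrt_iter T (Suc n) x - sqrt_iter T n x) + (sqrt_iter T n x - sqrt_iter T m x))
    \<le> (sqrt_bound (Suc n) - sqrt_bound n) * norm x + (sqrt_bound n - sqrt_bound m) * norm x"
    using sqrt_iter_step step.IH by (rule norm_triangle_mono)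
  then show ?case
    by (simp add: algebra_simps del: sqrt_iter.simps sqrt_bound.simps)
qed simp

lemma sqrt_iter_Cauchy: "Cauchy (\<lambda>n. sqrt_iter T n x)"
proof (rule CauchyI')
  fix e :: real assume "e > 0"
  \<comment> \<open>Adding 1 keeps the denominator positive for \<open>x = 0\<close>.\<close>
  then have "e / (norm x + 1) > 0"
    by (simp add: add_nonneg_pos)
  then obtain M where
    M: "\<And>m n. m \<ge> M \<Longrightarrow> n \<ge> M \<Longrightarrow> norm (sqrt_bound m - sqrt_bound n) < e / (norm x + 1)"
    using sqrt_bound_Cauchy by (meson CauchyD)
  have "norm (sqrt_iter T m x - sqrt_iter T n x) < e" if "m \<ge> M" "n > m" for m n
  proof -
    have "norm (sqrt_iter T m x - sqrt_iter T n x) \<le> (sqrt_bound n - sqrt_bound m) * norm x"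
      using sqrt_iter_diff[of m n x] that by (simp add: norm_minus_commute)
    moreover have "\<dots> \<le> (sqrt_bound n - sqrt_bound m) * (norm x + 1)"
      using sqrt_bound_incseq that by (intro mult_left_mono) (auto simp: incseq_def)
    moreover have "sqrt_bound n - sqrt_bound m < e / (norm x + 1)"
      using M[of n m] that by auto
    then have "(sqrt_bound n - sqrt_bound m) * (norm x + 1) < e"
      by (simp add: pos_less_divide_eq add_nonneg_pos)
    ultimately show ?thesis
      by linarith
  qed
  then show "\<exists>M. \<forall>m\<ge>M. \<forall>n>m. dist (sqrt_iter T m x) (sqrt_iter T n x) < e"
    by (auto simp: dist_norm)
qed

definition one_minus_sqrt :: "'a \<Rightarrow> 'a" where
  "one_minus_sqrt x = lim (\<lambda>n. sqrt_iter T n x)"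

lemma one_minus_sqrt_limit: "(\<lambda>n. sqrt_iter T n x) \<longlonglongrightarrow> one_minus_sqrt x"
  unfolding one_minus_sqrt_def
  using sqrt_iter_Cauchy Cauchy_convergent convergent_LIMSEQ_iff by blast

lemma one_minus_sqrt_linear: "linear one_minus_sqrt"
proof (rule linearI)
  fix x y and c :: real
  have "(\<lambda>n. sqrt_iter T n (x + y)) \<longlonglongrightarrow> one_minus_sqrt x + one_minus_sqrt y"
    unfolding linear_add[OF sqrt_iter_linear] by (intro tendsto_intros one_minus_sqrt_limit)
  then show "one_minus_sqrt (x + y) = one_minus_sqrt x + one_minus_sqrt y"
    using one_minus_sqrt_limit LIMSEQ_unique by blast
  have "(\<lambda>n. sqrt_iter T n (c *\<^sub>R x)) \<longlonglongrightarrow> c *\<^sub>R one_minus_sqrt x"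
    unfolding linear_cmul[OF sqrt_iter_linear] by (intro tendsto_intros one_minus_sqrt_limit)
  then show "one_minus_sqrt (c *\<^sub>R x) = c *\<^sub>R one_minus_sqrt x"
    using one_minus_sqrt_limit LIMSEQ_unique by blast
qed

lemma sqrt_iter_contraction: "norm (sqrt_iter T n x) \<le> norm x"
proof -
  have "sqrt_bound n * norm x \<le> 1 * norm x"
    using sqrt_bound_range by (intro mult_right_mono) simp_all
  then show ?thesis
    using sqrt_iter_norm[of n x] by linarith
qed

lemma one_minus_sqrt_norm: "norm (one_minus_sqrt x) \<le> norm x"
  by (rule LIMSEQ_le_const2[OF tendsto_norm[OF one_minus_sqrt_limit]])
    (simp add: sqrt_iter_contraction)

lemma one_minus_sqrt_symmetric: "inner (one_minus_sqrt x) y = inner x (one_minus_sqrt y)"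
proof -
  have "(\<lambda>n. inner (sqrt_iter T n x) y) \<longlonglongrightarrow> inner (one_minus_sqrt x) y"
    "(\<lambda>n. inner x (sqrt_iter T n y)) \<longlonglongrightarrow> inner x (one_minus_sqrt y)"
    by (intro tendsto_intros one_minus_sqrt_limit)+
  then show ?thesis
    unfolding sqrt_iter_symmetric by (rule LIMSEQ_unique)
qed

text \<open>The limit of the recurrence, amounting to \<open>(1 - S)^2 = 1 - T\<close>.\<close>

lemma one_minus_sqrt_fixpoint:
  "2 *\<^sub>R one_minus_sqrt x = T x + one_minus_sqrt (one_minus_sqrt x)"
proof -
  let ?S = one_minus_sqrt
  have "(\<lambda>n. norm (sqrt_iter T n x - ?S x)) \<longlonglongrightarrow> 0"
    using one_minus_sqrt_limit LIM_zero tendsto_norm_zero by blast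
  \<comment> \<open>In the composed term both operator and argument vary with \<open>n\<close>.
    Since all iterates are contractions, replacing the inner argument by its limit costs an error
    tending to 0.\<close>
  then have "(\<lambda>n. sqrt_iter T n (sqrt_iter T n x - ?S x)) \<longlonglongrightarrow> 0"
    by (rule Lim_null_comparison[rotated]) (simp add: sqrt_iter_contraction)
  then have "(\<lambda>n. sqrt_iter T n (sqrt_iter T n x - ?S x) + sqrt_iter T n (?S x)) \<longlonglongrightarrow> 0 + ?S (?S x)"
    using one_minus_sqrt_limit by (rule tendsto_add)
  then have "(\<lambda>n. sqrt_iter T n (sqrt_iter T n x)) \<longlonglongrightarrow> ?S (?S x)"
    by (simp add: linear_diff[OF sqrt_iter_linear])
  then have "(\<lambda>n. sqrt_iter T (Suc n) x) \<longlonglongrightarrow> (1/2) *\<^sub>R (T x + ?S (?S x))"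
    unfolding sqrt_iter.simps by (intro tendsto_intros)
  moreover have "(\<lambda>n. sqrt_iter T (Suc n) x) \<longlonglongrightarrow> ?S x"
    using one_minus_sqrt_limit by (rule LIMSEQ_Suc)
  ultimately have "?S x = (1/2) *\<^sub>R (T x + ?S (?S x))"
    by (rule LIMSEQ_unique[rotated])
  then have "2 *\<^sub>R ?S x = 2 *\<^sub>R (1/2) *\<^sub>R (T x + ?S (?S x))"
    by simp
  then show ?thesis
    by simp
qed

text \<open>Each iterate is built from \<open>T\<close> by sums, multiples and composition, so it
  commutes with \<open>U\<close>; continuity of \<open>U\<close> carries this to the limit.\<close>

lemma one_minus_sqrt_commute:
  assumes U: "bounded_linear U" and TU: "\<And>x. U (T x) = T (U x)"
  shows "U (one_minus_sqrt x) = one_minus_sqrt (U x)"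
proof -
  have linU: "linear U"
    using U by (rule bounded_linear.linear)
  have "U (sqrt_iter T n x) = sqrt_iter T n (U x)" for n x
    by (induction n arbitrary: x)
      (simp_all add: linear_0[OF linU] linear_cmul[OF linU] linear_add[OF linU] TU)
  moreover have "(\<lambda>n. U (sqrt_iter T n x)) \<longlonglongrightarrow> U (one_minus_sqrt x)"
    using U one_minus_sqrt_limit by (rule bounded_linear.tendsto)
  ultimately have "(\<lambda>n. sqrt_iter T n (U x)) \<longlonglongrightarrow> U (one_minus_sqrt x)"
    by simp
  then show ?thesis
    using one_minus_sqrt_limit by (rule LIMSEQ_unique)
qed

end

subsection \<open>Splitting a self-adjoint graph\<close>

text \<open>\<open>G\<close> is a relation equal to its own adjoint. Viewing it as a subset of
  \<open>H x H\<close> allows projecting onto it, which produces bounded operators.\<close>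

locale self_adjoint_graph =
  fixes G :: "('a::{real_inner, complete_space} \<times> 'a) set"
  assumes self_adjoint: "(x, y) \<in> G \<longleftrightarrow> (\<forall>u v. (u, v) \<in> G \<longrightarrow> inner v x = inner u y)"
begin

lemma symmetric: "(u, v) \<in> G \<Longrightarrow> (x, y) \<in> G \<Longrightarrow> inner v x = inner u y"
  using self_adjoint[of x y] by simp

text \<open>For fixed \<open>(u, v)\<close> the defining condition is linear in
  \<open>(x, y)\<close>; its continuity gives closedness below.\<close>

lemma subspace: "subspace G"
proof -
  have "(0, 0) \<in> G"
    by (subst self_adjoint) simp
  moreover have "(x + x', y + y') \<in> G" if "(x, y) \<in> G" "(x', y') \<in> G" for x y x' y'
    using that by (subst self_adjoint) (simp add: inner_add symmetric)
  moreover have "(c *\<^sub>R x, c *\<^sub>R y) \<in> G" if "(x, y) \<in> G" for c x y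
    using that by (subst self_adjoint) (simp add: symmetric)
  ultimately show ?thesis
    by (auto simp: subspace_def zero_prod_def)
qed

lemma add: "(x, y) \<in> G \<Longrightarrow> (x', y') \<in> G \<Longrightarrow> (x + x', y + y') \<in> G"
  using subspace_add[OF subspace] by fastforce

lemma diff: "(x, y) \<in> G \<Longrightarrow> (x', y') \<in> G \<Longrightarrow> (x - x', y - y') \<in> G"
  using subspace_diff[OF subspace] by fastforce

lemma scaleR: "(x, y) \<in> G \<Longrightarrow> (c *\<^sub>R x, c *\<^sub>R y) \<in> G"
  using subspace_scale[OF subspace] by fastforce

lemma closed: "closed G"
proof -
  have "p \<in> G \<longleftrightarrow> p \<in> (\<Inter>w\<in>G. {p. inner (snd w) (fst p) = inner (fst w) (snd p)})" for p
    using self_adjoint[of "fst p" "snd p"] by auto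
  then have "G = (\<Inter>w\<in>G. {p. inner (snd w) (fst p) = inner (fst w) (snd p)})"
    by blast
  moreover have "closed (\<Inter>w\<in>G. {p. inner (snd w) (fst p) = inner (fst w) (snd p)})"
    by (intro closed_INT ballI closed_Collect_eq continuous_intros)
  ultimately show ?thesis
    by simp
qed

section \<open>Bounded operators \<open>R\<close> and \<open>B\<close> attached to the graph\<close>

definition resolvent_pair :: "'a \<Rightarrow> 'a \<Rightarrow> 'a \<Rightarrow> bool" where
  "resolvent_pair x r b \<longleftrightarrow> (r, b) \<in> G \<and> (b, x - r) \<in> G"

text \<open>Project \<open>(x, 0)\<close> onto \<open>G\<close>, obtaining \<open>(r, b)\<close>.
  That the residual \<open>(x - r, - b)\<close> is orthogonal to \<open>G\<close> is precisely the
  adjoint condition for \<open>(b, x - r)\<close>.\<close>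

lemma resolvent_pair_exists: "\<exists>r b. resolvent_pair x r b"
proof -
  obtain p q where p: "p \<in> G" and q: "q \<in> G\<^sup>\<bottom>" and eq: "(x, 0) = p + q"
    using orthogonal_decomposition[OF subspace closed] by metis
  obtain r b where rb: "p = (r, b)"
    by fastforce
  from eq have "q = (x, 0) - p"
    by simp
  with rb have "q = (x - r, - b)"
    by simp
  with q have "inner v b = inner u (x - r)" if "(u, v) \<in> G" for u v
    using orthogonal_comp_inner[OF that q] by simp
  then have "(b, x - r) \<in> G"
    by (subst self_adjoint) simp
  with p rb show ?thesis
    by (auto simp: resolvent_pair_def)
qed

text \<open>Symmetry of \<open>G\<close> applied to the two difference pairs equates the squared
  norm of \<open>b - b'\<close> with minus that of \<open>r - r'\<close>.\<close>

lemma resolvent_pair_unique: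
  assumes "resolvent_pair x r b" and "resolvent_pair x r' b'"
  shows "r = r' \<and> b = b'"
proof -
  have "(r - r', b - b') \<in> G" "(b - b', (x - r) - (x - r')) \<in> G"
    using assms unfolding resolvent_pair_def by (blast intro: diff)+
  then have "inner (b - b') (b - b') = inner (r - r') ((x - r) - (x - r'))"
    by (rule symmetric)
  also have "\<dots> = - inner (r - r') (r - r')"
    by (simp add: inner_diff_right)
  finally have "inner (b - b') (b - b') + inner (r - r') (r - r') = 0"
    by simp
  then have "inner (b - b') (b - b') = 0 \<and> inner (r - r') (r - r') = 0"
    by (simp only: add_nonneg_eq_0_iff inner_ge_zero)
  then show ?thesis
    by simp
qed

text \<open>If \<open>G\<close> is the graph of \<open>A\<close>, these are \<open>R = (1 + A\<^sup>2)\<^sup>-\<^sup>1\<close> and \<open>B = A R\<close>.\<close>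

definition R :: "'a \<Rightarrow> 'a" where
  "R x = (THE r. \<exists>b. resolvent_pair x r b)"

definition B :: "'a \<Rightarrow> 'a" where
  "B x = (THE b. \<exists>r. resolvent_pair x r b)"

lemma resolvent_pair_iff: "resolvent_pair x r b \<longleftrightarrow> r = R x \<and> b = B x"
proof -
  have eq: "r = R x \<and> b = B x" if "resolvent_pair x r b" for r b
    unfolding R_def B_def using that resolvent_pair_unique by (auto intro!: the_equality[symmetric])
  then show ?thesis
    using resolvent_pair_exists by metis
qed

lemma RB: "(R x, B x) \<in> G" and BR: "(B x, x - R x) \<in> G"
  using resolvent_pair_iff[of x "R x" "B x"] by (auto simp: resolvent_pair_def)

lemma RB_eqI: "(r, b) \<in> G \<Longrightarrow> (b, x - r) \<in> G \<Longrightarrow> R x = r \<and> B x = b"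
  using resolvent_pair_iff[of x r b] by (auto simp: resolvent_pair_def)

lemma RB_add: "R (x + y) = R x + R y \<and> B (x + y) = B x + B y"
  using add[OF RB RB, of x y] add[OF BR BR, of x y] by (intro RB_eqI) (simp_all add: algebra_simps)

lemma RB_scaleR: "R (c *\<^sub>R x) = c *\<^sub>R R x \<and> B (c *\<^sub>R x) = c *\<^sub>R B x"
  using scaleR[OF RB, of c x] scaleR[OF BR, of c x] by (intro RB_eqI) (simp_all add: algebra_simps)

lemma linear_R: "linear R" and linear_B: "linear B"
  using RB_add RB_scaleR by (simp_all add: linear_iff)

text \<open>Such a \<open>U\<close> maps a resolvent pair of \<open>x\<close> to one of
  \<open>U x\<close>. It is applied to \<open>R\<close> itself and to scalar
  multiplications.\<close>

lemma RB_commute: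
  assumes "linear U" and "\<And>x y. (x, y) \<in> G \<Longrightarrow> (U x, U y) \<in> G"
  shows "R (U x) = U (R x) \<and> B (U x) = U (B x)"
  using assms(2)[OF RB, of x] assms(2)[OF BR, of x]
  by (intro RB_eqI) (simp_all add: linear_diff[OF assms(1)])

text \<open>Subtracting \<open>(B y, y - R y)\<close> from \<open>(x, y)\<close> leaves
  \<open>(x - B y, R y)\<close> in \<open>G\<close>; together with \<open>(R y, B y)\<close> this
  makes a resolvent pair of \<open>x\<close>.\<close>

lemma graph_imp: "(x, y) \<in> G \<Longrightarrow> R x = x - B y \<and> B x = R y"
  using diff[OF _ BR, of x y y] RB[of y] by (intro RB_eqI) simp_all

text \<open>The right side says that the projection with rows \<open>(R, B)\<close> and
  \<open>(B, 1 - R)\<close> fixes \<open>(x, y)\<close>, so membership in \<open>G\<close> is tested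
  by bounded operators alone.\<close>

lemma graph_iff: "(x, y) \<in> G \<longleftrightarrow> R x = x - B y \<and> B x = R y"
proof
  assume "R x = x - B y \<and> B x = R y"
  then show "(x, y) \<in> G"
    using add[OF RB[of x] BR[of y]] by simp
qed (rule graph_imp)

lemma R_graph: "(x, y) \<in> G \<Longrightarrow> (R x, R y) \<in> G"
  using graph_imp[of x y] RB[of x] by simp

lemma R_B: "B (R x) = R (B x)"
  using RB_commute[OF linear_R R_graph] by blast

text \<open>Symmetry of \<open>G\<close> gives \<open><x, R y> = <R x, R y> + <B x, B y>\<close>,
  whose right side is symmetric in \<open>x\<close> and \<open>y\<close>.\<close>

lemma R_symmetric: "inner (R x) y = inner x (R y)"
proof -
  have "inner (x - R x) (R y) = inner (B x) (B y)" for x y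
    using symmetric[OF BR RB] .
  from this[of x y] this[of y x] show ?thesis
    by (simp add: inner_diff inner_commute)
qed

lemma B_symmetric: "inner (B x) y = inner x (B y)"
proof -
  have "inner (x - R x) (B y) = inner (B x) (y - R y)"
    using symmetric[OF BR BR] .
  moreover have "inner (B x) (R y) = inner (R x) (B y)"
    using symmetric[OF RB RB] .
  ultimately show ?thesis
    by (simp add: inner_diff)
qed

text \<open>The squared norms of \<open>R x\<close> and \<open>B x\<close> sum to
  \<open><x, R x>\<close>; Cauchy-Schwarz bounds first \<open>R x\<close>, then
  \<open>B x\<close>.\<close>

lemma RB_norm: "norm (R x) \<le> norm x \<and> norm (B x) \<le> norm x"
proof -
  have "inner (x - R x) (R x) = inner (B x) (B x)"
    using symmetric[OF BR RB] .
  then have "(norm (B x))\<^sup>2 + (norm (R x))\<^sup>2 = inner x (R x)"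
    by (simp add: inner_diff power2_norm_eq_inner)
  also have "\<dots> \<le> norm x * norm (R x)"
    by (rule norm_cauchy_schwarz)
  finally have *: "(norm (B x))\<^sup>2 + (norm (R x))\<^sup>2 \<le> norm x * norm (R x)" .
  then have "norm (R x) * norm (R x) \<le> norm x * norm (R x)"
    by (smt (verit) power2_eq_square zero_le_power2)
  then have R: "norm (R x) \<le> norm x"
    by (cases "R x = 0") auto
  then have "norm x * norm (R x) \<le> norm x * norm x"
    by (intro mult_left_mono) auto
  with * have "(norm (B x))\<^sup>2 \<le> (norm x)\<^sup>2"
    by (smt (verit) power2_eq_square zero_le_power2)
  with R show ?thesis
    by (meson norm_ge_zero power2_le_imp_le)
qed

lemma bounded_linear_R: "bounded_linear R" and bounded_linear_B: "bounded_linear B"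
  using linear_R linear_B RB_norm
  by (auto simp: bounded_linear_axioms_def intro!: bounded_linear.intro exI[of _ 1])

section \<open>The absolute value of \<open>B\<close>, as \<open>sqrt (1 - T)\<close> with
  \<open>T = 1 - B^2\<close>\<close>

sublocale sqrt: symmetric_contraction "\<lambda>x. x - B (B x)"
proof (rule symmetric_contraction.intro)
  show "linear (\<lambda>x. x - B (B x))"
    using linear_B by (simp add: linear_iff algebra_simps)
  show "inner (x - B (B x)) y = inner x (y - B (B y))" for x y
    by (simp add: inner_diff B_symmetric)
  show "norm (x - B (B x)) \<le> norm x" for x
  proof -
    have "(norm (x - B (B x)))\<^sup>2 = (norm x)\<^sup>2 - 2 * (norm (B x))\<^sup>2 + (norm (B (B x)))\<^sup>2"
      using B_symmetric[of x "B x"]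
      by (simp add: power2_norm_eq_inner inner_diff inner_commute algebra_simps)
    moreover have "(norm (B (B x)))\<^sup>2 \<le> (norm (B x))\<^sup>2"
      using RB_norm by (intro power_mono) auto
    ultimately have "(norm (x - B (B x)))\<^sup>2 \<le> (norm x)\<^sup>2"
      by (smt (verit) zero_le_power2)
    then show ?thesis
      by (meson norm_ge_zero power2_le_imp_le)
  qed
qed

definition abs_B :: "'a \<Rightarrow> 'a" where
  "abs_B x = x - sqrt.one_minus_sqrt x"

lemma linear_abs_B: "linear abs_B"
  using sqrt.one_minus_sqrt_linear by (simp add: abs_B_def linear_iff algebra_simps)

lemma abs_B_symmetric: "inner (abs_B x) y = inner x (abs_B y)"
  by (simp add: abs_B_def inner_diff sqrt.one_minus_sqrt_symmetric)

text \<open>The subtracted operator \<open>one_minus_sqrt\<close> is a contraction, so its quadratic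
  form is at most the squared norm of \<open>x\<close>.\<close>

lemma abs_B_nonneg: "0 \<le> inner (abs_B x) x"
proof -
  have "inner (sqrt.one_minus_sqrt x) x \<le> norm (sqrt.one_minus_sqrt x) * norm x"
    by (rule norm_cauchy_schwarz)
  also have "\<dots> \<le> norm x * norm x"
    using sqrt.one_minus_sqrt_norm by (intro mult_right_mono) auto
  finally show ?thesis
    by (simp add: abs_B_def inner_diff power2_norm_eq_inner flip: power2_eq_square)
qed

lemma abs_B_square: "abs_B (abs_B x) = B (B x)"
proof -
  have "abs_B (abs_B x)
      = x - 2 *\<^sub>R sqrt.one_minus_sqrt x + sqrt.one_minus_sqrt (sqrt.one_minus_sqrt x)"
    unfolding abs_B_def by (simp add: linear_diff[OF sqrt.one_minus_sqrt_linear] scaleR_2)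
  then show ?thesis
    by (simp add: sqrt.one_minus_sqrt_fixpoint)
qed

lemma abs_B_commute:
  assumes "bounded_linear U" and "\<And>x. U (B x) = B (U x)"
  shows "U (abs_B x) = abs_B (U x)"
proof -
  have linU: "linear U"
    using assms(1) by (rule bounded_linear.linear)
  then have "U (sqrt.one_minus_sqrt x) = sqrt.one_minus_sqrt (U x)"
    using assms by (intro sqrt.one_minus_sqrt_commute) (simp_all add: linear_diff)
  then show ?thesis
    by (simp add: abs_B_def linear_diff[OF linU])
qed

section \<open>The nonnegative part, which contains the kernel of \<open>B\<close>, and its
  orthogonal complement\<close>

definition pos_part :: "'a set" where
  "pos_part = {x. abs_B x = B x}"

lemma subspace_pos_part: "subspace pos_part"
  unfolding pos_part_def
  by (auto simp: subspace_def linear_0 linear_add linear_cmul linear_abs_B linear_B)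

lemma closed_pos_part: "closed pos_part"
proof -
  have "bounded_linear sqrt.one_minus_sqrt"
    using sqrt.one_minus_sqrt_linear sqrt.one_minus_sqrt_norm
    by (auto simp: bounded_linear_axioms_def intro!: bounded_linear.intro exI[of _ 1])
  then show ?thesis
    unfolding pos_part_def abs_B_def
    by (intro closed_Collect_eq continuous_intros linear_continuous_on bounded_linear_B)
qed

lemma pos_part_invariant:
  assumes "bounded_linear U" and "\<And>x. U (B x) = B (U x)" and "x \<in> pos_part"
  shows "U x \<in> pos_part"
proof -
  have "abs_B (U x) = U (abs_B x)"
    using abs_B_commute[OF assms(1,2)] by simp
  also have "\<dots> = B (U x)"
    using assms(3) by (simp add: pos_part_def assms(2))
  finally show ?thesis
    by (simp add: pos_part_def)
qed

lemma neg_part_invariant: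
  assumes "\<And>x. x \<in> pos_part \<Longrightarrow> U x \<in> pos_part" and "\<And>x y. inner (U x) y = inner x (U y)"
    and "x \<in> pos_part\<^sup>\<bottom>"
  shows "U x \<in> pos_part\<^sup>\<bottom>"
proof -
  have "inner y (U x) = 0" if "y \<in> pos_part" for y
    using orthogonal_comp_inner[OF assms(1)[OF that] assms(3)] assms(2) by simp
  then show ?thesis
    by (simp add: orthogonal_comp_def orthogonal_def)
qed

lemma R_pos_part: "x \<in> pos_part \<Longrightarrow> R x \<in> pos_part"
  by (rule pos_part_invariant[OF bounded_linear_R]) (simp_all add: R_B)

lemma B_pos_part: "x \<in> pos_part \<Longrightarrow> B x \<in> pos_part"
  by (rule pos_part_invariant[OF bounded_linear_B]) simp_all

lemma R_neg_part: "x \<in> pos_part\<^sup>\<bottom> \<Longrightarrow> R x \<in> pos_part\<^sup>\<bottom>"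
  using neg_part_invariant[OF R_pos_part R_symmetric] .

lemma B_neg_part: "x \<in> pos_part\<^sup>\<bottom> \<Longrightarrow> B x \<in> pos_part\<^sup>\<bottom>"
  using neg_part_invariant[OF B_pos_part B_symmetric] .

text \<open>From \<open>(|B| - B) (|B| + B) = 0\<close>, the range of \<open>|B| + B\<close> lies in \<^term>\<open>pos_part\<close>.\<close>

lemma neg_part_B:
  assumes "x \<in> pos_part\<^sup>\<bottom>"
  shows "B x = - abs_B x"
proof -
  have comm: "B (abs_B x) = abs_B (B x)" for x
    by (rule abs_B_commute[OF bounded_linear_B]) simp
  have abs_B_pos_part: "abs_B w \<in> pos_part" if "w \<in> pos_part" for w
    using that B_pos_part[OF that] by (simp add: pos_part_def)
  have "abs_B (abs_B x + B x) = B (abs_B x + B x)"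
    by (simp add: linear_add[OF linear_abs_B] linear_add[OF linear_B] abs_B_square comm)
  then have "abs_B x + B x \<in> pos_part"
    by (simp add: pos_part_def)
  moreover have "abs_B x \<in> pos_part\<^sup>\<bottom>"
    using assms by (intro neg_part_invariant[where U = abs_B] abs_B_pos_part abs_B_symmetric)
  then have "abs_B x + B x \<in> pos_part\<^sup>\<bottom>"
    using B_neg_part[OF assms] subspace_orthogonal_comp by (intro subspace_add)
  ultimately have "inner (abs_B x + B x) (abs_B x + B x) = 0"
    by (rule orthogonal_comp_inner)
  then have "abs_B x + B x = 0"
    by simp
  then show ?thesis
    by (simp add: add_eq_0_iff)
qed

text \<open>Substituting \<open>x = R x + B y\<close> and \<open>R y = B x\<close> expresses the
  form of the possibly unbounded operator by that of \<open>B\<close>, so the sign of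
  \<open>B\<close> decides.\<close>

lemma inner_graph:
  assumes "(x, y) \<in> G"
  shows "inner y x = inner (B x) x + inner (B y) y"
proof -
  have "inner y x = inner y (R x) + inner y (B y)"
    using graph_imp[OF assms] by (simp add: inner_diff)
  also have "inner y (R x) = inner (B x) x"
    using graph_imp[OF assms] by (simp add: R_symmetric)
  finally show ?thesis
    by (simp add: inner_commute)
qed

lemma pos_part_nonneg:
  assumes "(x, y) \<in> G" "x \<in> pos_part" "y \<in> pos_part"
  shows "0 \<le> inner y x"
  using assms abs_B_nonneg[of x] abs_B_nonneg[of y] by (simp add: inner_graph pos_part_def)

lemma neg_part_nonpos:
  assumes "(x, y) \<in> G" "x \<in> pos_part\<^sup>\<bottom>" "y \<in> pos_part\<^sup>\<bottom>"
  shows "inner y x \<le> 0"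
  using assms abs_B_nonneg[of x] abs_B_nonneg[of y] by (simp add: inner_graph neg_part_B)

text \<open>Decompose \<open>y\<close> and write membership in \<open>G\<close> as the two equations
  of \<open>graph_iff\<close>. As \<open>R\<close> and \<open>B\<close> leave both subspaces
  invariant, each equation splits into components, giving membership for each part
  separately.\<close>

lemma graph_splits:
  assumes "(u + v, y) \<in> G" and u: "u \<in> pos_part" and v: "v \<in> pos_part\<^sup>\<bottom>"
  obtains u' v' where "(u, u') \<in> G" "u' \<in> pos_part" "(v, v') \<in> G" "v' \<in> pos_part\<^sup>\<bottom>" "y = u' + v'"
proof -
  obtain u' v' where u': "u' \<in> pos_part" and v': "v' \<in> pos_part\<^sup>\<bottom>" and y: "y = u' + v'"
    using orthogonal_decomposition[OF subspace_pos_part closed_pos_part] by metis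
  have R_eq: "R u + R v = (u - B u') + (v - B v')" and B_eq: "B u + B v = R u' + R v'"
    using graph_imp[OF assms(1)] unfolding y
    by (simp_all add: linear_add[OF linear_R] linear_add[OF linear_B])
  note parts = u v u' v' R_pos_part B_pos_part R_neg_part B_neg_part
    subspace_diff[OF subspace_pos_part] subspace_diff[OF subspace_orthogonal_comp]
  have "R u = u - B u' \<and> R v = v - B v'"
    using R_eq by (rule orthogonal_decomposition_unique[OF subspace_pos_part]) (blast intro: parts)+
  moreover have "B u = R u' \<and> B v = R v'"
    using B_eq by (rule orthogonal_decomposition_unique[OF subspace_pos_part]) (blast intro: parts)+
  ultimately show thesis
    using u' v' y by (intro that[of u' v']) (auto simp: graph_iff)
qed

end

subsection \<open>The real inner product of a real or complex Hilbert space\<close>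

context hilbert_space
begin

lemma conj_0: "conj (0::'k) = 0"
  using conj_scaleR[of 0 "0::'k"] by simp

lemma conj_diff: "conj (x - y) = conj x - conj (y::'k)"
  using conj_add[of "x - y" y] by simp

lemma ip_add_right: "ip x (y + z) = ip x y + ip x z"
  using ip_commute[of x "y + z"] ip_commute[of x y] ip_commute[of x z]
  by (simp add: ip_add_left conj_add)

lemma ip_scale_right: "ip x (scale c y) = conj c * ip x y"
  using ip_commute[of x "scale c y"] ip_commute[of x y] by (simp add: ip_scale_left conj_mult)

lemma ip_zero_left: "ip 0 x = 0"
  using ip_add_left[of 0 0 x] by simp

lemma ip_eq_0_commute: "ip x y = 0 \<Longrightarrow> ip y x = 0"
  using ip_commute[where x = x and y = y] conj_0 by simp

text \<open>Comparing the expansions of the squared norm of \<open>x + y\<close> by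
  \<open>ip\<close> and by \<open>inner\<close> identifies \<open>inner\<close> as the real part of
  \<open>ip\<close>.\<close>

lemma ip_polarization: "ip x y + ip y x = of_real (2 * inner x y)"
proof -
  have "(norm (x + y))\<^sup>2 = (norm x)\<^sup>2 + 2 * inner x y + (norm y)\<^sup>2"
    by (simp add: power2_norm_eq_inner inner_add inner_commute)
  then have "of_real ((norm (x + y))\<^sup>2)
      = (of_real ((norm x)\<^sup>2) + of_real (2 * inner x y) + of_real ((norm y)\<^sup>2) :: 'k)"
    by (simp only: of_real_add)
  then show ?thesis
    by (simp only: ip_add_left ip_add_right flip: ip_self) (simp add: algebra_simps)
qed

lemma inner_eq_if_ip_eq:
  assumes "ip a b = ip c d"
  shows "inner a b = inner c d"
proof -
  have "ip b a = ip d c"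
    using assms ip_commute by metis
  then have "(of_real (2 * inner a b) :: 'k) = of_real (2 * inner c d)"
    using assms by (simp only: flip: ip_polarization)
  then show ?thesis
    by (simp only: of_real_eq_iff)
qed

text \<open>All scalars \<open>c\<close> together recover what the real part alone loses. With
  \<open>z\<close> the difference of the two sides, \<open>c = conj z\<close> shows that
  \<open>w = conj z * z\<close> satisfies \<open>w + conj w = 0\<close>; being self-conjugate,
  \<open>w\<close> vanishes.\<close>

lemma ip_eq_if_inner_eq:
  assumes "\<And>c. inner (scale c a) b = inner (scale c a') b'"
  shows "ip a b = ip a' b'"
proof -
  define z where "z = ip a b - ip a' b'"
  define w where "w = conj z * z"
  have eq: "conj z * ip a b + conj (conj z * ip a b) = conj z * ip a' b' + conj (conj z * ip a' b')"
    using ip_polarization[of "scale (conj z) a" b] ip_polarization[of "scale (conj z) a'" b']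
      ip_commute[of b "scale (conj z) a"] ip_commute[of b' "scale (conj z) a'"]
      assms[of "conj z"]
    by (simp add: ip_scale_left)
  have w: "w = conj z * ip a b - conj z * ip a' b'"
    by (simp add: w_def z_def algebra_simps)
  have "w + conj w = (conj z * ip a b + conj (conj z * ip a b))
      - (conj z * ip a' b' + conj (conj z * ip a' b'))"
    unfolding w by (simp add: conj_diff)
  then have "w + conj w = 0"
    using eq by simp
  moreover have "conj w = w"
    by (simp add: w_def conj_mult conj_conj mult.commute)
  ultimately have "2 * w = 0"
    by (simp only: mult_2)
  then have "z * conj z = 0"
    by (simp add: w_def mult.commute)
  then have "z = 0"
    by (simp add: mult_conj)
  then show ?thesis
    by (simp add: z_def)
qed

lemma norm_scale: "norm (scale c x) = norm c * norm x"
proof -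
  have "of_real ((norm (scale c x))\<^sup>2) = c * conj c * ip x x"
    by (simp only: ip_self[symmetric] ip_scale_left ip_scale_right mult_ac)
  also have "\<dots> = of_real ((norm c * norm x)\<^sup>2)"
    by (simp add: mult_conj ip_self power_mult_distrib scaleR_conv_of_real)
  finally have "(norm (scale c x))\<^sup>2 = (norm c * norm x)\<^sup>2"
    by (simp only: of_real_eq_iff)
  then show ?thesis
    by simp
qed

lemma bounded_linear_scale: "bounded_linear (scale c)"
proof (rule bounded_linear_intro)
  show "scale c (x + y) = scale c x + scale c y" for x y
    by (rule scale_right_distrib)
  show "scale c (r *\<^sub>R x) = r *\<^sub>R scale c x" for r x
    by (simp add: mult.commute flip: scale_of_real)
  show "norm (scale c x) \<le> norm x * norm c" for x
    by (simp add: norm_scale)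
qed

text \<open>The difference of two values is orthogonal to \<open>dom A\<close>, hence to its
  closure, which contains the difference itself.\<close>

lemma adjoint_value_unique:
  assumes "subspace S" and "S \<subseteq> closure (dom A)"
    and "is_adjoint_value S A y z" and "is_adjoint_value S A y z'"
  shows "z = z'"
proof -
  have "inner x z = inner x z'" if "x \<in> dom A" for x
    using assms(3,4) that by (intro inner_eq_if_ip_eq) (simp add: is_adjoint_value_def)
  then have "dom A \<subseteq> {x. inner x (z - z') = 0}"
    by (auto simp: inner_diff)
  moreover have "closed {x. inner x (z - z') = 0}"
    by (intro closed_Collect_eq continuous_intros)
  ultimately have "closure (dom A) \<subseteq> {x. inner x (z - z') = 0}"
    by (rule closure_minimal)
  moreover have "z - z' \<in> S"
    using assms by (simp add: is_adjoint_value_def subspace_diff)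
  ultimately have "inner (z - z') (z - z') = 0"
    using assms(2) by blast
  then show ?thesis
    by simp
qed

lemma adjoint_in_eq_Some_iff:
  assumes "subspace S" and "S \<subseteq> closure (dom A)"
  shows "adjoint_in S A y = Some z \<longleftrightarrow> y \<in> S \<and> is_adjoint_value S A y z"
proof -
  have "(THE z. is_adjoint_value S A y z) = z" if "is_adjoint_value S A y z" for z
    using that adjoint_value_unique[OF assms] by blast
  then show ?thesis
    unfolding adjoint_in_def by auto
qed

end

subsection \<open>Reducing subspaces of a self-adjoint operator\<close>

locale self_adjoint_operator = hilbert_space +
  fixes A
  assumes self_adjoint: "self_adjoint_in UNIV A"
begin

lemma A_linear_operator: "linear_operator_in UNIV A"
  using self_adjoint by (simp add: self_adjoint_in_def)

lemma dom_dense: "closure (dom A) = UNIV"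
  using self_adjoint by (auto simp: self_adjoint_in_def)

lemma subspace_dom: "subspace (dom A)"
  using A_linear_operator by (simp add: linear_operator_in_def)

lemma A_add:
  assumes "A x = Some x'" and "A y = Some y'"
  shows "A (x + y) = Some (x' + y')"
proof -
  have dom: "x \<in> dom A" "y \<in> dom A"
    using assms by auto
  then have "x + y \<in> dom A"
    using subspace_dom by (intro subspace_add)
  moreover have "the (A (x + y)) = x' + y'"
    using A_linear_operator dom assms by (simp add: linear_operator_in_def)
  ultimately show ?thesis
    by auto
qed

lemma A_scale:
  assumes "A x = Some y"
  shows "A (scale c x) = Some (scale c y)"
proof -
  have dom: "x \<in> dom A"
    using assms by auto
  then have "scale c x \<in> dom A"
    using subspace_dom by (intro subspace_scale)
  moreover have "the (A (scale c x)) = scale c y"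
    using A_linear_operator dom assms by (simp add: linear_operator_in_def)
  ultimately show ?thesis
    by auto
qed

lemma A_eq_Some_iff: "A y = Some z \<longleftrightarrow> (\<forall>u v. A u = Some v \<longrightarrow> ip v y = ip u z)"
proof -
  have "A y = Some z \<longleftrightarrow> adjoint_in UNIV A y = Some z"
    using self_adjoint by (simp add: self_adjoint_in_def)
  also have "\<dots> \<longleftrightarrow> is_adjoint_value UNIV A y z"
    by (subst adjoint_in_eq_Some_iff) (simp_all add: dom_dense subspace_UNIV)
  also have "\<dots> \<longleftrightarrow> (\<forall>u v. A u = Some v \<longrightarrow> ip v y = ip u z)"
  proof
    assume "is_adjoint_value UNIV A y z"
    then have "ip (the (A u)) y = ip u z" if "u \<in> dom A" for u
      using that by (simp add: is_adjoint_value_def)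
    then show "\<forall>u v. A u = Some v \<longrightarrow> ip v y = ip u z"
      using domI by fastforce
  qed (auto simp: is_adjoint_value_def)
  finally show ?thesis .
qed

sublocale graph: self_adjoint_graph "{(x, y). A x = Some y}"
proof (rule self_adjoint_graph.intro)
  fix x y
  have "A x = Some y \<longleftrightarrow> (\<forall>u v. A u = Some v \<longrightarrow> inner v x = inner u y)"
  proof
    assume "A x = Some y"
    then show "\<forall>u v. A u = Some v \<longrightarrow> inner v x = inner u y"
      unfolding A_eq_Some_iff[of x y] by (auto intro: inner_eq_if_ip_eq)
  next
    assume *: "\<forall>u v. A u = Some v \<longrightarrow> inner v x = inner u y"
    \<comment> \<open>The graph is closed under scalars, so the hypothesis also holds for
      \<open>scale c u\<close> and \<open>scale c v\<close> with every \<open>c\<close>.\<close>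
    have "ip v x = ip u y" if "A u = Some v" for u v
      using * A_scale[OF that] by (intro ip_eq_if_inner_eq) blast
    then show "A x = Some y"
      unfolding A_eq_Some_iff[of x y] by blast
  qed
  then show "(x, y) \<in> {(x, y). A x = Some y}
      \<longleftrightarrow> (\<forall>u v. (u, v) \<in> {(x, y). A x = Some y} \<longrightarrow> inner v x = inner u y)"
    by simp
qed

text \<open>Symmetry of \<open>A\<close>, tested on the pair \<open>(x, y)\<close> itself, makes
  \<open>ip y x\<close> equal to its swapped product; polarization then gives its value.\<close>

lemma ip_A_real: "A x = Some y \<Longrightarrow> ip y x = of_real (inner y x)"
proof -
  assume "A x = Some y"
  then have "ip y x = ip x y"
    using A_eq_Some_iff by blast
  then have "2 * ip y x = 2 * of_real (inner y x)"
    using ip_polarization[of y x] by (simp only: mult_2 of_real_add)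
  then show ?thesis
    by simp
qed

text \<open>Stated for any orthogonal pair \<open>U\<close>, \<open>V\<close> that splits
  \<open>A\<close>, so that it serves both subspaces with the roles exchanged.\<close>

lemma restriction_self_adjoint:
  assumes U: "subspace U" and V: "subspace V"
    and orth: "\<And>u v. u \<in> U \<Longrightarrow> v \<in> V \<Longrightarrow> ip u v = 0"
    and decomp: "\<And>x. \<exists>u\<in>U. \<exists>v\<in>V. x = u + v"
    and split: "\<And>u v y. u \<in> U \<Longrightarrow> v \<in> V \<Longrightarrow> A (u + v) = Some y
      \<Longrightarrow> \<exists>u'\<in>U. \<exists>v'\<in>V. A u = Some u' \<and> A v = Some v'"
  shows "self_adjoint_in U (A |` U)"
proof -
  have dom: "dom (A |` U) = dom A \<inter> U"
    by simp
  have A_U: "y \<in> U" if "u \<in> U" "A u = Some y" for u y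
    using split[of u 0 y] that subspace_0[OF V] by auto
  have "subspace (dom A \<inter> U)"
    using subspace_dom U by (rule subspace_inter)
  moreover have "ran (A |` U) \<subseteq> U"
    using A_U by (auto simp: ran_def restrict_map_def split: if_splits)
  moreover have "the ((A |` U) (x + y)) = the ((A |` U) x) + the ((A |` U) y)"
    if "x \<in> dom A \<inter> U" "y \<in> dom A \<inter> U" for x y
    using that A_add subspace_add[OF U] by auto
  moreover have "the ((A |` U) (scale c x)) = scale c (the ((A |` U) x))"
    if "x \<in> dom A \<inter> U" for c x
    using that A_scale subspace_scale[OF U] by auto
  ultimately have linear: "linear_operator_in U (A |` U)"
    unfolding linear_operator_in_def dom by blast
  have dense: "U \<subseteq> closure (dom (A |` U))"
  proof
    fix u assume "u \<in> U"
    show "u \<in> closure (dom (A |` U))"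
      unfolding closure_approachable
    proof (intro allI impI)
      fix e :: real assume "e > 0"
      moreover have "u \<in> closure (dom A)"
        using dom_dense by simp
      ultimately obtain x where x: "x \<in> dom A" "dist x u < e"
        unfolding closure_approachable by blast
      \<comment> \<open>The component \<open>a\<close> in \<open>U\<close> replaces the approximant
        \<open>x\<close>: by Pythagoras it is no farther from \<open>u\<close>, and
        \<open>split\<close> keeps it in \<open>dom A\<close>.\<close>
      obtain a b where ab: "a \<in> U" "b \<in> V" "x = a + b"
        using decomp by blast
      have "a - u \<in> U"
        using U \<open>u \<in> U\<close> ab(1) by (intro subspace_diff)
      then have "ip (a - u) b = ip 0 0"
        using orth ab(2) by (simp add: ip_zero_left)
      then have "inner (a - u) b = 0"
        using inner_eq_if_ip_eq by fastforce
      then have "(norm (x - u))\<^sup>2 = (norm (a - u))\<^sup>2 + (norm b)\<^sup>2"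
        unfolding ab(3) power2_norm_eq_inner by (simp add: inner_add inner_diff inner_commute)
      then have "(norm (a - u))\<^sup>2 \<le> (norm (x - u))\<^sup>2"
        by simp
      then have "norm (a - u) \<le> norm (x - u)"
        by (meson norm_ge_zero power2_le_imp_le)
      then have "dist a u < e"
        using x(2) by (simp add: dist_norm)
      moreover have "a \<in> dom A"
        using split[OF ab(1,2)] x(1) ab(3) by blast
      ultimately show "\<exists>y\<in>dom (A |` U). dist y u < e"
        using ab(1) dom by blast
    qed
  qed
  have "is_adjoint_value U (A |` U) y z \<longleftrightarrow> A y = Some z" if "y \<in> U" for y z
  proof
    assume adj: "is_adjoint_value U (A |` U) y z"
    then have "z \<in> U"
      by (simp add: is_adjoint_value_def)
    \<comment> \<open>A test vector from all of \<open>dom A\<close> splits, and its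
      \<open>V\<close> part contributes 0 on both sides because \<open>y\<close> and
      \<open>z\<close> lie in \<open>U\<close>.\<close>
    have "ip w y = ip x z" if x: "A x = Some w" for x w
    proof -
      obtain a b where ab: "a \<in> U" "b \<in> V" "x = a + b"
        using decomp by blast
      then obtain a' b' where a'b': "a' \<in> U" "b' \<in> V" "A a = Some a'" "A b = Some b'"
        using split x by blast
      then have "w = a' + b'"
        using A_add x ab(3) by fastforce
      moreover have "ip a' y = ip a z"
        using adj ab(1) a'b'(3) dom by (force simp: is_adjoint_value_def)
      moreover have "ip b' y = 0" "ip b z = 0"
        using orth ip_eq_0_commute \<open>y \<in> U\<close> \<open>z \<in> U\<close> ab(2) a'b'(2) by blast+
      ultimately show ?thesis
        by (simp add: ab(3) ip_add_left)
    qed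
    then show "A y = Some z"
      unfolding A_eq_Some_iff[of y z] by blast
  next
    assume "A y = Some z"
    then show "is_adjoint_value U (A |` U) y z"
      using A_U[OF \<open>y \<in> U\<close>] A_eq_Some_iff[of y z] by (auto simp: is_adjoint_value_def)
  qed
  then have "adjoint_in U (A |` U) y = Some z \<longleftrightarrow> (A |` U) y = Some z" for y z
    unfolding adjoint_in_eq_Some_iff[OF U dense] by (auto simp: restrict_map_def)
  then have "adjoint_in U (A |` U) y = (A |` U) y" for y
    by (metis not_Some_eq)
  then have "adjoint_in U (A |` U) = A |` U"
    by (rule ext)
  with linear dense show ?thesis
    by (simp add: self_adjoint_in_def)
qed

section \<open>The reducing subspaces of \<open>A\<close> over the scalar field\<close>

abbreviation "Hp \<equiv> graph.pos_part"
abbreviation "Hm \<equiv> Hp\<^sup>\<bottom>"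

text \<open>Scalar multiplication preserves the graph, hence commutes with \<open>B\<close> and
  leaves \<open>pos_part\<close> invariant.\<close>

lemma scale_Hp: "x \<in> Hp \<Longrightarrow> scale c x \<in> Hp"
proof (rule graph.pos_part_invariant[OF bounded_linear_scale])
  show "scale c (graph.B x) = graph.B (scale c x)" for x
    using graph.RB_commute[OF bounded_linear.linear[OF bounded_linear_scale], of c] A_scale
    by simp
qed

text \<open>Invariance of \<open>Hp\<close> under scalars makes every \<open>scale c u\<close>
  orthogonal to \<open>v\<close> in the real sense, which forces \<open>ip u v\<close> to
  vanish.\<close>

lemma ip_Hp_Hm:
  assumes "u \<in> Hp" and "v \<in> Hm"
  shows "ip u v = 0"
proof -
  have "ip u v = ip 0 0"
    using orthogonal_comp_inner[OF scale_Hp assms(2)] assms(1)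
    by (intro ip_eq_if_inner_eq) simp
  then show ?thesis
    by (simp add: ip_zero_left)
qed

lemma scale_Hm:
  assumes "x \<in> Hm"
  shows "scale c x \<in> Hm"
proof -
  have "inner u (scale c x) = 0" if "u \<in> Hp" for u
    using ip_Hp_Hm[OF that assms] inner_eq_if_ip_eq[of u "scale c x" 0 0]
    by (simp add: ip_scale_right ip_zero_left)
  then show ?thesis
    by (simp add: orthogonal_comp_def orthogonal_def)
qed

lemma subspace_Hp: "subspace Hp"
  using graph.subspace_pos_part scale_Hp
  by (simp add: subspace_def Real_Vector_Spaces.subspace_def)

lemma subspace_Hm: "subspace Hm"
  using subspace_orthogonal_comp[of Hp] scale_Hm
  by (simp add: subspace_def Real_Vector_Spaces.subspace_def)

lemma decomposition: obtains u v where "u \<in> Hp" "v \<in> Hm" "x = u + v"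
  using orthogonal_decomposition[OF graph.subspace_pos_part graph.closed_pos_part] by metis

lemma A_splits:
  assumes "u \<in> Hp" "v \<in> Hm" "A (u + v) = Some y"
  obtains u' v' where "A u = Some u'" "u' \<in> Hp" "A v = Some v'" "v' \<in> Hm" "y = u' + v'"
  using graph.graph_splits[of u v y] assms by auto

lemma decomposition_swapped: "\<exists>u\<in>Hm. \<exists>v\<in>Hp. x = u + v"
proof -
  obtain u v where "u \<in> Hp" "v \<in> Hm" "x = u + v"
    by (rule decomposition)
  then have "x = v + u"
    by (simp add: add.commute)
  with \<open>u \<in> Hp\<close> \<open>v \<in> Hm\<close> show ?thesis
    by blast
qed

lemma A_splits_swapped:
  assumes "u \<in> Hm" "v \<in> Hp" "A (u + v) = Some y"
  obtains u' v' where "A u = Some u'" "u' \<in> Hm" "A v = Some v'" "v' \<in> Hp" "y = u' + v'"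
proof -
  have "A (v + u) = Some y"
    using assms(3) by (simp add: add.commute)
  with assms(2,1) obtain v' u' where
    "A v = Some v'" "v' \<in> Hp" "A u = Some u'" "u' \<in> Hm" "y = v' + u'"
    by (rule A_splits)
  then show thesis
    using that[of u' v'] by (simp add: add.commute)
qed

lemma A_Hp:
  assumes "A x = Some y" and "x \<in> Hp"
  shows "y \<in> Hp"
proof -
  \<comment> \<open>The zero vector serves as the component in \<open>Hm\<close>.\<close>
  have "A (x + 0) = Some y"
    using assms(1) by simp
  with assms(2) subspace_0[OF subspace_Hm] obtain y' where "A x = Some y'" "y' \<in> Hp"
    by (rule A_splits)
  then show ?thesis
    using assms(1) by simp
qed

lemma A_Hm:
  assumes "A x = Some y" and "x \<in> Hm"
  shows "y \<in> Hm"
proof -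
  have "A (x + 0) = Some y"
    using assms(1) by simp
  with assms(2) subspace_0[OF subspace_Hp] obtain y' where "A x = Some y'" "y' \<in> Hm"
    by (rule A_splits_swapped)
  then show ?thesis
    using assms(1) by simp
qed

lemma self_adjoint_Hp: "self_adjoint_in Hp (A |` Hp)"
proof (rule restriction_self_adjoint[OF subspace_Hp subspace_Hm ip_Hp_Hm])
  show "\<exists>u\<in>Hp. \<exists>v\<in>Hm. x = u + v" for x
    by (rule decomposition[of x]) blast
  show "\<exists>u'\<in>Hp. \<exists>v'\<in>Hm. A u = Some u' \<and> A v = Some v'"
    if "u \<in> Hp" "v \<in> Hm" "A (u + v) = Some y" for u v y
    using that by (rule A_splits) blast
qed

lemma self_adjoint_Hm: "self_adjoint_in Hm (A |` Hm)"
proof (rule restriction_self_adjoint[OF subspace_Hm subspace_Hp])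
  show "ip u v = 0" if "u \<in> Hm" "v \<in> Hp" for u v
    using that(2,1) by (rule ip_eq_0_commute[OF ip_Hp_Hm])
  show "\<exists>u\<in>Hm. \<exists>v\<in>Hp. x = u + v" for x
    by (rule decomposition_swapped)
  show "\<exists>u'\<in>Hm. \<exists>v'\<in>Hp. A u = Some u' \<and> A v = Some v'"
    if "u \<in> Hm" "v \<in> Hp" "A (u + v) = Some y" for u v y
    using that by (rule A_splits_swapped) blast
qed

lemma orthogonal_direct_sum_Hm_Hp: "orthogonal_direct_sum UNIV Hm Hp"
proof -
  have "ip u v = 0" if "u \<in> Hm" "v \<in> Hp" for u v
    using that(2,1) by (rule ip_eq_0_commute[OF ip_Hp_Hm])
  moreover have "UNIV = {u + v |u v. u \<in> Hm \<and> v \<in> Hp}"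
    using decomposition_swapped by (intro set_eqI) blast
  ultimately show ?thesis
    by (simp add: orthogonal_direct_sum_def)
qed

lemma operator_direct_sum_Hm_Hp: "operator_direct_sum Hm Hp A (A |` Hm) (A |` Hp)"
  unfolding operator_direct_sum_def
proof (intro ballI conjI impI)
  fix u v assume uv: "u \<in> Hm" "v \<in> Hp"
  show "u + v \<in> dom A \<longleftrightarrow> u \<in> dom (A |` Hm) \<and> v \<in> dom (A |` Hp)"
  proof
    assume "u + v \<in> dom A"
    then obtain y where "A (u + v) = Some y"
      by blast
    with uv show "u \<in> dom (A |` Hm) \<and> v \<in> dom (A |` Hp)"
      by (rule A_splits_swapped) (use uv in \<open>simp add: domI\<close>)
  next
    assume "u \<in> dom (A |` Hm) \<and> v \<in> dom (A |` Hp)"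
    then show "u + v \<in> dom A"
      using subspace_add[OF subspace_dom] by simp
  qed
  assume "u + v \<in> dom A"
  then obtain y where y: "A (u + v) = Some y"
    by blast
  with uv obtain u' v' where
    "A u = Some u'" "u' \<in> Hm" "A v = Some v'" "v' \<in> Hp" "y = u' + v'"
    by (rule A_splits_swapped)
  with y uv show "the (A (u + v)) = the ((A |` Hm) u) + the ((A |` Hp) v)"
    "the ((A |` Hm) u) \<in> Hm" "the ((A |` Hp) v) \<in> Hp"
    by simp_all
qed

lemma nonneg_operator_Hp: "nonneg_operator (A |` Hp)"
  unfolding nonneg_operator_def
proof
  fix x assume "x \<in> dom (A |` Hp)"
  then obtain y where x: "x \<in> Hp" and y: "A x = Some y"
    by auto
  then have "0 \<le> inner y x"
    using A_Hp graph.pos_part_nonneg[of x y] by simp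
  then show "ip (the ((A |` Hp) x)) x \<in> \<real>\<^sub>\<ge>\<^sub>0"
    using x y by (simp add: ip_A_real)
qed

lemma nonpos_operator_Hm: "nonpos_operator (A |` Hm)"
  unfolding nonpos_operator_def
proof
  fix x assume "x \<in> dom (A |` Hm)"
  then obtain y where x: "x \<in> Hm" and y: "A x = Some y"
    by auto
  then have "inner y x \<le> 0"
    using A_Hm graph.neg_part_nonpos[of x y] by simp
  then show "ip (the ((A |` Hm) x)) x \<in> \<real>\<^sub>\<le>\<^sub>0"
    using x y by (simp add: ip_A_real)
qed

end

theorem lemma6:
  fixes scale :: "'k::real_or_complex \<Rightarrow> 'h::{real_inner, complete_space} \<Rightarrow> 'h"
    and ip :: "'h \<Rightarrow> 'h \<Rightarrow> 'k"
    and A :: "'h \<rightharpoonup> 'h"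
  assumes "hilbert_space scale ip"
    and "hilbert_space.self_adjoint_in scale ip UNIV A"
  shows "\<exists>Hm Hp.
    hilbert_space.closed_subspace scale Hm \<and>
    hilbert_space.closed_subspace scale Hp \<and>
    hilbert_space.self_adjoint_in scale ip Hm (A |` Hm) \<and>
    hilbert_space.self_adjoint_in scale ip Hp (A |` Hp) \<and>
    hilbert_space.orthogonal_direct_sum ip UNIV Hm Hp \<and>
    hilbert_space.operator_direct_sum Hm Hp A (A |` Hm) (A |` Hp) \<and>
    hilbert_space.nonpos_operator ip (A |` Hm) \<and>
    hilbert_space.nonneg_operator ip (A |` Hp)"
proof -
  interpret hilbert_space scale ip
    by (rule assms(1))
  interpret self_adjoint_operator scale ip A
    by unfold_locales (rule assms(2))
  have "closed_subspace Hm" "closed_subspace Hp"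
    using subspace_Hm subspace_Hp closed_orthogonal_comp graph.closed_pos_part
    by (simp_all add: closed_subspace_def)
  then show ?thesis
    using self_adjoint_Hm self_adjoint_Hp orthogonal_direct_sum_Hm_Hp operator_direct_sum_Hm_Hp
      nonpos_operator_Hm nonneg_operator_Hp
    by blast
qed

end
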